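(* Let $L>3$ be an integer, $\tau>0$, $\gamma>0$, $\alpha\in\mathbb R\setminus\{0\}$, and let $K\in\mathbb C^{M\times M}$ be self-adjoint ($K=K^*$) with eigenvalues $\{\sigma_m\}_{m=1}^M$. Assume that for every $m$, $1+\tau\sigma_m\ne0$ and, writing $\varphi_m=(1+\tau\sigma_m)^{-1}$ and $\psi_m=\frac\tau\gamma(1+\tau\sigma_m)^{-1}$, that $\varphi_m\ne\pm1$ and $\alpha\varphi_m^L\neq1$. Let $A$ and $P(\alpha)$ be, respectively, the implicit-Euler terminal-cost all-at-once matrix and its ParaDiag preconditioner, as defined in the context. Then the eigenvalues of the preconditioned system matrix $P(\alpha)^{-1}A$ are all either $1$ or equal to $$\theta_{m,\{1,2\}}=1+\omega_{m,\{1,2\}}$$ for some $m\in\{1,\dots,M\}$, where $\omega_{m,1},\omega_{m,2}$ are the eigenvalues of the matrix $$\begin{bmatrix}\dfrac{\alpha\varphi^L}{1-\alpha\varphi^L}+\dfrac{\psi}{(1-\alpha\varphi^L)^2}\dfrac{1-\varphi^{2L}}{1-\varphi^2}&-\dfrac{\alpha\varphi\psi}{(1-\alpha\varphi^L)^2}\dfrac{1-\varphi^{2L}}{1-\varphi^2}\\[2ex]-\dfrac{\varphi^{L-1}}{1-\alpha\varphi^L}&\dfrac{\alpha\varphi^L}{1-\alpha\varphi^L}\end{bmatrix}$$ with $\varphi=\varphi_m$ and $\psi=\psi_m$.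
   Context: Here $L$ is the number of time steps, $\tau$ the time step and $\gamma$ the regularization parameter. Let $I_t$ be the $L\times L$ identity, $I_x$ the $M\times M$ identity, and $\otimes$ the Kronecker product. Let $B\in\mathbb R^{L\times L}$ have $1$ on the diagonal, $-1$ on the first subdiagonal and zeros elsewhere; let $E\in\mathbb R^{L\times L}$ have a single non-zero entry, a $1$ in the bottom-right corner; and let $C(\alpha)\in\mathbb R^{L\times L}$ be equal to $B$ except that its top-right entry (row $1$, column $L$) is $-\alpha$. Define $$A=\begin{bmatrix}B&\frac\tau\gamma I_t\\-E&B^\top\end{bmatrix}\otimes I_x+\tau\begin{bmatrix}I_t\otimes K&0\\-E\otimes K^*&I_t\otimes K^*\end{bmatrix},\qquad P(\alpha)=\begin{bmatrix}C(\alpha)&\frac\tau\gamma I_t\\0&C(\alpha)^*\end{bmatrix}\otimes I_x+\tau\begin{bmatrix}I_t\otimes K&0\\0&I_t\otimes K^*\end{bmatrix}.$$ *)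

theory Defs
  imports
    "Jordan_Normal_Form.Schur_Decomposition"
    "Jordan_Normal_Form.Gauss_Jordan_Elimination"
begin

definition kron :: "'a :: times mat \<Rightarrow> 'a mat \<Rightarrow> 'a mat"  (infixl \<open>\<otimes>\<^sub>K\<close> 70) where
  "X \<otimes>\<^sub>K Y = mat (dim_row X * dim_row Y) (dim_col X * dim_col Y)
     (\<lambda>(i, j). X $$ (i div dim_row Y, j div dim_col Y) * Y $$ (i mod dim_row Y, j mod dim_col Y))"

text \<open>The matrices of the implicit-Euler time discretisation with L time steps. Indices start
  at 0, so row 1 and column L of the usual notation are row 0 and column L - 1.\<close>

definition B_mat :: "nat \<Rightarrow> complex mat" where
  "B_mat L = mat L L (\<lambda>(i, j). if i = j then 1 else if i = Suc j then -1 else 0)"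

definition E_mat :: "nat \<Rightarrow> complex mat" where
  "E_mat L = mat L L (\<lambda>(i, j). if i = L - 1 \<and> j = L - 1 then 1 else 0)"

definition C_mat :: "nat \<Rightarrow> real \<Rightarrow> complex mat" where
  "C_mat L \<alpha> = mat L L (\<lambda>(i, j). if i = 0 \<and> j = L - 1 then - of_real \<alpha> else B_mat L $$ (i, j))"

definition A_mat :: "nat \<Rightarrow> real \<Rightarrow> real \<Rightarrow> complex mat \<Rightarrow> complex mat" where
  "A_mat L \<tau> \<gamma> K =
     (let It = 1\<^sub>m L; Ix = 1\<^sub>m (dim_row K); N = L * dim_row K in
      four_block_mat
        (B_mat L)       (of_real (\<tau> / \<gamma>) \<cdot>\<^sub>m It)
        (- E_mat L)     (transpose_mat (B_mat L)) \<otimes>\<^sub>K Ix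
      + of_real \<tau> \<cdot>\<^sub>m four_block_mat
        (It \<otimes>\<^sub>K K)                            (0\<^sub>m N N)
        ((- E_mat L) \<otimes>\<^sub>K mat_adjoint K)       (It \<otimes>\<^sub>K mat_adjoint K))"

definition P_mat :: "nat \<Rightarrow> real \<Rightarrow> real \<Rightarrow> real \<Rightarrow> complex mat \<Rightarrow> complex mat" where
  "P_mat L \<tau> \<gamma> \<alpha> K =
     (let It = 1\<^sub>m L; Ix = 1\<^sub>m (dim_row K); N = L * dim_row K in
      four_block_mat
        (C_mat L \<alpha>)     (of_real (\<tau> / \<gamma>) \<cdot>\<^sub>m It)
        (0\<^sub>m L L)        (mat_adjoint (C_mat L \<alpha>)) \<otimes>\<^sub>K Ix
      + of_real \<tau> \<cdot>\<^sub>m four_block_mat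
        (It \<otimes>\<^sub>K K)      (0\<^sub>m N N)
        (0\<^sub>m N N)        (It \<otimes>\<^sub>K mat_adjoint K))"

definition W_mat :: "nat \<Rightarrow> complex \<Rightarrow> complex \<Rightarrow> complex \<Rightarrow> complex mat" where
  "W_mat L \<alpha> \<phi> \<psi> = mat_of_rows_list 2
     [[\<alpha> * \<phi> ^ L / (1 - \<alpha> * \<phi> ^ L)
         + \<psi> / (1 - \<alpha> * \<phi> ^ L)\<^sup>2 * ((1 - \<phi> ^ (2 * L)) / (1 - \<phi>\<^sup>2)),
       - (\<alpha> * \<phi> * \<psi> / (1 - \<alpha> * \<phi> ^ L)\<^sup>2 * ((1 - \<phi> ^ (2 * L)) / (1 - \<phi>\<^sup>2)))],
      [- (\<phi> ^ (L - 1) / (1 - \<alpha> * \<phi> ^ L)),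
       \<alpha> * \<phi> ^ L / (1 - \<alpha> * \<phi> ^ L)]]"

end

theory Submission
  imports Defs
begin

text \<open>Since \<open>K\<close> is self-adjoint, the system matrix and the preconditioner both have the form
  \<open>X \<otimes> I + \<tau> (Y \<otimes> K)\<close>, where \<open>X\<close> and \<open>Y\<close> are \<open>2L \<times> 2L\<close> matrices acting on time only; so
  does every combination \<open>A - \<theta> P\<close>. Triangularising \<open>K\<close> shows that a non-zero
  vector in the kernel of such a matrix yields a non-zero vector in the kernel of
  \<open>X + \<tau> \<sigma>\<^sub>m Y\<close> for some eigenvalue \<open>\<sigma>\<^sub>m\<close> of \<open>K\<close> (\<open>kron_pencil_kernel\<close>). It
  remains to compare the two scalar symbols \<open>a = A_time + \<tau> \<sigma>\<^sub>m A_space\<close> and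
  \<open>p = P_time + \<tau> \<sigma>\<^sub>m P_space\<close>.

  The symbols agree up to a few corner entries: applied to a state \<open>y\<close> and an adjoint \<open>\<lambda>\<close>, the
  difference \<open>a - p\<close> only reads the last state \<open>y\<^sub>L\<^sub>-\<^sub>1\<close> and the first adjoint \<open>\<lambda>\<^sub>0\<close>. An
  eigenvalue \<open>\<theta> \<noteq> 1\<close> of the pencil means \<open>p \<zeta> = \<eta> (a - p) \<zeta>\<close> with \<open>\<eta> = 1 / (\<theta> - 1)\<close>. This
  equation is a first-order recurrence backward in time for \<open>\<lambda>\<close>, a first-order recurrence
  forward in time for \<open>y\<close> with source \<open>\<lambda>\<close>, and two coupling conditions at the ends. Solving both
  recurrences turns the coupling conditions into a \<open>2 \<times> 2\<close> system for \<open>(y\<^sub>L\<^sub>-\<^sub>1, \<lambda>\<^sub>0)\<close>, which says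
  that this vector is an eigenvector of \<open>W_mat\<close> for the eigenvalue \<open>1 / \<eta> = \<theta> - 1\<close>
  (\<open>backward_forward_sweep\<close>, \<open>symbol_resonance\<close>).

  The value \<open>\<eta> = 0\<close> describes a kernel vector of \<open>p\<close>, and the same computation excludes it,
  because \<open>1 - \<alpha> \<phi>\<^sup>L \<noteq> 0\<close>; hence the preconditioner is invertible.\<close>

section \<open>Matrix--vector algebra\<close>

lemma smult_mat_mult_vec:
  assumes "v \<in> carrier_vec (dim_col A)"
  shows "(c \<cdot>\<^sub>m A) *\<^sub>v v = c \<cdot>\<^sub>v (A *\<^sub>v (v :: 'a :: comm_ring_1 vec))"
  using assms by (intro eq_vecI) (auto simp: scalar_prod_def sum_distrib_left mult.assoc)

lemma zero_mat_mult_vec: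
  "v \<in> carrier_vec m \<Longrightarrow> 0\<^sub>m n m *\<^sub>v v = (0\<^sub>v n :: 'a :: semiring_1 vec)"
  by (intro eq_vecI) auto

lemma index_mat_adjoint:
  assumes "i < dim_col A" "j < dim_row A"
  shows "mat_adjoint A $$ (i, j) = conjugate (A $$ (j, i))"
  using assms by (simp add: mat_adjoint_def mat_of_rows_def)

lemma dim_mat_adjoint [simp]:
  "dim_row (mat_adjoint A) = dim_col A" "dim_col (mat_adjoint A) = dim_row A"
  by (simp_all add: mat_adjoint_def)

text \<open>A pencil in \<open>\<theta>\<close> of pencils in \<open>t\<close> is a pencil in \<open>t\<close> of pencils in \<open>\<theta>\<close>. This is used with
  \<open>t = \<tau>\<close> for the Kronecker products and with \<open>t = \<tau> \<sigma>\<^sub>m\<close> for the scalar symbols.\<close>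

lemma pencil_rearrange:
  fixes A B C D :: "'a :: comm_ring_1 mat"
  assumes "A \<in> carrier_mat n m" "B \<in> carrier_mat n m" "C \<in> carrier_mat n m" "D \<in> carrier_mat n m"
  shows "(A - \<theta> \<cdot>\<^sub>m C) + t \<cdot>\<^sub>m (B - \<theta> \<cdot>\<^sub>m D) = (A + t \<cdot>\<^sub>m B) - \<theta> \<cdot>\<^sub>m (C + t \<cdot>\<^sub>m D)"
  using assms by (intro eq_matI) (auto simp: algebra_simps)

section \<open>Kernels of Kronecker pencils\<close>

text \<open>Quotient and remainder by \<open>M\<close> turn the flat index of a Kronecker product into a pair of a
  time index and a space index.\<close>

lemma sum_div_mod:
  fixes f :: "nat \<Rightarrow> nat \<Rightarrow> 'a :: comm_monoid_add"
  shows "(\<Sum>i<N * M. f (i div M) (i mod M)) = (\<Sum>k<N. \<Sum>x<M. f k x)"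
proof -
  have "(\<Sum>i<N * M. f (i div M) (i mod M)) = (\<Sum>k<N. \<Sum>i\<in>{k * M..<k * M + M}. f (i div M) (i mod M))"
    by (rule sum.nat_group[symmetric])
  also have "\<dots> = (\<Sum>k<N. \<Sum>x<M. f k x)"
  proof -
    have "{k * M..<k * M + M} = (\<lambda>x. k * M + x) ` {..<M}" for k
      by (simp add: lessThan_atLeast0 add.commute)
    then show ?thesis
      by (simp add: sum.reindex)
  qed
  finally show ?thesis .
qed

lemma div_mod_less: "i < n * (m::nat) \<Longrightarrow> i div m < n" "i < n * m \<Longrightarrow> i mod m < m"
  by (cases "m = 0"; simp add: less_mult_imp_div_less)+

text \<open>This is the column-stacking operator \<open>vec\<close>. The columns are indexed by time and the rows by
  space, which matches the time-major order of \<open>time \<otimes> space\<close>.\<close>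

definition vectorise :: "'a mat \<Rightarrow> 'a vec" where
  "vectorise Z = vec (dim_col Z * dim_row Z) (\<lambda>i. Z $$ (i mod dim_row Z, i div dim_row Z))"

lemma vectorise_surj:
  assumes "z \<in> carrier_vec (N * M)"
  obtains Z where "Z \<in> carrier_mat M N" "z = vectorise Z"
proof
  show "mat M N (\<lambda>(x, k). z $ (k * M + x)) \<in> carrier_mat M N" by simp
  show "z = vectorise (mat M N (\<lambda>(x, k). z $ (k * M + x)))"
    using assms by (intro eq_vecI) (auto simp: vectorise_def div_mod_less)
qed

lemma vectorise_eq_0_iff:
  assumes "Z \<in> carrier_mat M N"
  shows "vectorise Z = 0\<^sub>v (N * M) \<longleftrightarrow> Z = 0\<^sub>m M N"
proof
  assume eq: "vectorise Z = 0\<^sub>v (N * M)"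
  show "Z = 0\<^sub>m M N"
  proof (rule eq_matI)
    fix x k assume "x < dim_row (0\<^sub>m M N :: 'a mat)" "k < dim_col (0\<^sub>m M N :: 'a mat)"
    then have x: "x < M" and k: "k < N" by auto
    have "k * M + x < N * M"
    proof -
      have "k * M + x < Suc k * M" using x by simp
      also have "\<dots> \<le> N * M" using k by (intro mult_le_mono1) simp
      finally show ?thesis .
    qed
    with arg_cong[OF eq, of "\<lambda>v. v $ (k * M + x)"] assms x k
    show "Z $$ (x, k) = 0\<^sub>m M N $$ (x, k)" by (simp add: vectorise_def)
  qed (use assms in auto)
qed (use assms in \<open>auto simp: vectorise_def div_mod_less\<close>)

text \<open>The identity \<open>(X \<otimes> Y) vec(Z) = vec(Y Z X\<^sup>T)\<close> separates the two factors: the space matrix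
  acts from the left, the time matrix from the right.\<close>

lemma kron_mult_vectorise:
  fixes X Y Z :: "'a :: comm_semiring_0 mat"
  assumes "X \<in> carrier_mat n N" "Y \<in> carrier_mat m M" "Z \<in> carrier_mat M N"
  shows "(X \<otimes>\<^sub>K Y) *\<^sub>v vectorise Z = vectorise (Y * Z * X\<^sup>T)"
proof (rule eq_vecI)
  fix i assume "i < dim_vec (vectorise (Y * Z * X\<^sup>T))"
  then have i: "i < n * m" using assms by (simp add: vectorise_def)
  then have k: "i div m < n" and x: "i mod m < m" by (simp_all add: div_mod_less)
  have "((X \<otimes>\<^sub>K Y) *\<^sub>v vectorise Z) $ i
      = (\<Sum>j<N * M. X $$ (i div m, j div M) * Y $$ (i mod m, j mod M) * Z $$ (j mod M, j div M))"
    using i assms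
    by (auto simp: kron_def vectorise_def scalar_prod_def atLeast0LessThan intro!: sum.cong)
  also have "\<dots> = (\<Sum>l<N. \<Sum>y<M. X $$ (i div m, l) * Y $$ (i mod m, y) * Z $$ (y, l))"
    by (rule sum_div_mod)
  also have "\<dots> = (\<Sum>y<M. \<Sum>l<N. X $$ (i div m, l) * Y $$ (i mod m, y) * Z $$ (y, l))"
    by (rule sum.swap)
  also have "\<dots> = (\<Sum>y<M. Y $$ (i mod m, y) * (\<Sum>l<N. Z $$ (y, l) * X $$ (i div m, l)))"
    by (simp add: sum_distrib_left ac_simps)
  also have "\<dots> = (Y * Z * X\<^sup>T) $$ (i mod m, i div m)"
    using assms k x by (simp add: scalar_prod_def atLeast0LessThan)
  also have "\<dots> = vectorise (Y * Z * X\<^sup>T) $ i"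
    using i assms by (simp add: vectorise_def)
  finally show "((X \<otimes>\<^sub>K Y) *\<^sub>v vectorise Z) $ i = vectorise (Y * Z * X\<^sup>T) $ i" .
qed (use assms in \<open>simp add: vectorise_def kron_def\<close>)

lemma vectorise_add:
  assumes "Z \<in> carrier_mat M N" "Z' \<in> carrier_mat M N"
  shows "vectorise (Z + Z') = vectorise Z + vectorise Z'"
  using assms by (intro eq_vecI) (auto simp: vectorise_def div_mod_less)

lemma vectorise_smult: "vectorise (c \<cdot>\<^sub>m Z) = c \<cdot>\<^sub>v vectorise Z"
  by (intro eq_vecI) (auto simp: vectorise_def div_mod_less)

lemma kron_four_block:
  assumes "A \<in> carrier_mat n1 m1" "B \<in> carrier_mat n1 m2"
    "C \<in> carrier_mat n2 m1" "D \<in> carrier_mat n2 m2"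
  shows "four_block_mat A B C D \<otimes>\<^sub>K K
    = four_block_mat (A \<otimes>\<^sub>K K) (B \<otimes>\<^sub>K K) (C \<otimes>\<^sub>K K) (D \<otimes>\<^sub>K K)"
proof -
  have shift: "(i - k * n) div n = i div n - k" "(i - k * n) mod n = i mod n"
    if "\<not> i < k * n" for i k n :: nat
  proof -
    define j where "j = i - k * n"
    then have "i = k * n + j" using that by simp
    then show "(i - k * n) div n = i div n - k" "(i - k * n) mod n = i mod n"
      by (cases "n = 0", simp_all)
  qed
  have less: "i div n < k \<longleftrightarrow> i < k * n" if "i < l * n" for i k l n :: nat
  proof -
    have "n > 0" using that by (cases n) auto
    then show ?thesis by (rule div_less_iff_less_mult)
  qed
  show ?thesis
  proof (rule eq_matI)
    fix i j
    let ?k = "dim_row K" and ?l = "dim_col K"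
    assume "i < dim_row (four_block_mat (A \<otimes>\<^sub>K K) (B \<otimes>\<^sub>K K) (C \<otimes>\<^sub>K K) (D \<otimes>\<^sub>K K))"
      and "j < dim_col (four_block_mat (A \<otimes>\<^sub>K K) (B \<otimes>\<^sub>K K) (C \<otimes>\<^sub>K K) (D \<otimes>\<^sub>K K))"
    then have i: "i < (n1 + n2) * ?k" and j: "j < (m1 + m2) * ?l"
      using assms by (simp_all add: kron_def distrib_right)
    note dim = carrier_matD[OF assms(1)] carrier_matD[OF assms(2)] carrier_matD[OF assms(3)]
      carrier_matD[OF assms(4)]
    have i': "i div ?k < n1 \<longleftrightarrow> i < n1 * ?k" "i div ?k < n1 + n2" "i < n1 * ?k + n2 * ?k"
      using less[OF i] div_mod_less(1)[OF i] i by (simp_all only: distrib_right)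
    have j': "j div ?l < m1 \<longleftrightarrow> j < m1 * ?l" "j div ?l < m1 + m2" "j < m1 * ?l + m2 * ?l"
      using less[OF j] div_mod_less(1)[OF j] j by (simp_all only: distrib_right)
    have "(four_block_mat A B C D \<otimes>\<^sub>K K) $$ (i, j)
      = four_block_mat A B C D $$ (i div ?k, j div ?l) * K $$ (i mod ?k, j mod ?l)"
      using i j dim by (simp add: kron_def)
    then show "(four_block_mat A B C D \<otimes>\<^sub>K K) $$ (i, j)
      = four_block_mat (A \<otimes>\<^sub>K K) (B \<otimes>\<^sub>K K) (C \<otimes>\<^sub>K K) (D \<otimes>\<^sub>K K) $$ (i, j)"
      using i' j' dim
      by (cases "i < n1 * ?k"; cases "j < m1 * ?l") (simp_all add: kron_def distrib_right shift)
  qed (use assms in \<open>simp_all add: kron_def distrib_right\<close>)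
qed

lemma zero_kron: "0\<^sub>m n m \<otimes>\<^sub>K (K :: 'a :: mult_zero mat) = 0\<^sub>m (n * dim_row K) (m * dim_col K)"
  by (rule eq_matI) (auto simp: kron_def div_mod_less)

lemma kron_diff_smult_left:
  fixes X Y K :: "'a :: comm_ring_1 mat"
  assumes "X \<in> carrier_mat n m" "Y \<in> carrier_mat n m"
  shows "(X - c \<cdot>\<^sub>m Y) \<otimes>\<^sub>K K = (X \<otimes>\<^sub>K K) - c \<cdot>\<^sub>m (Y \<otimes>\<^sub>K K)"
  using assms by (intro eq_matI) (auto simp: kron_def div_mod_less algebra_simps)

text \<open>Written with the matrix \<open>Z\<close> whose columns are the time slices of \<open>z\<close>, the kernel equation
  is \<open>Z X\<^sup>T + c K Z Y\<^sup>T = 0\<close>. If \<open>K = P T Q\<close> with \<open>Q = P\<inverse>\<close> and \<open>T\<close> upper triangular, then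
  \<open>W = Q Z\<close> satisfies \<open>W X\<^sup>T + c T W Y\<^sup>T = 0\<close>. In the last non-zero row of \<open>W\<close> only the diagonal
  entry of \<open>T\<close> survives, so that this row solves the scalar equation for an eigenvalue of \<open>K\<close>.\<close>

lemma kron_pencil_kernel:
  fixes K X Y :: "'a :: conjugatable_ordered_field mat"
  assumes K: "K \<in> carrier_mat M M" and cp: "char_poly K = (\<Prod>\<sigma>\<leftarrow>es. [:- \<sigma>, 1:])"
    and X: "X \<in> carrier_mat N N" and Y: "Y \<in> carrier_mat N N"
    and z: "z \<in> carrier_vec (N * M)" "z \<noteq> 0\<^sub>v (N * M)"
    and ker: "(X \<otimes>\<^sub>K 1\<^sub>m M + c \<cdot>\<^sub>m (Y \<otimes>\<^sub>K K)) *\<^sub>v z = 0\<^sub>v (N * M)"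
  obtains \<sigma> \<zeta> where "\<sigma> \<in> set es" "\<zeta> \<in> carrier_vec N" "\<zeta> \<noteq> 0\<^sub>v N"
    "(X + (c * \<sigma>) \<cdot>\<^sub>m Y) *\<^sub>v \<zeta> = 0\<^sub>v N"
proof -
  obtain Z where Z: "Z \<in> carrier_mat M N" and z_eq: "z = vectorise Z"
    using vectorise_surj[OF z(1)] .
  have "vectorise (Z * X\<^sup>T + c \<cdot>\<^sub>m (K * Z * Y\<^sup>T)) = (X \<otimes>\<^sub>K 1\<^sub>m M + c \<cdot>\<^sub>m (Y \<otimes>\<^sub>K K)) *\<^sub>v z"
  proof -
    have kX: "X \<otimes>\<^sub>K 1\<^sub>m M \<in> carrier_mat (N * M) (N * M)"
      and kY: "Y \<otimes>\<^sub>K K \<in> carrier_mat (N * M) (N * M)"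
      using X Y K by (auto simp: kron_def)
    have "(X \<otimes>\<^sub>K 1\<^sub>m M + c \<cdot>\<^sub>m (Y \<otimes>\<^sub>K K)) *\<^sub>v z
        = (X \<otimes>\<^sub>K 1\<^sub>m M) *\<^sub>v z + c \<cdot>\<^sub>v ((Y \<otimes>\<^sub>K K) *\<^sub>v z)"
      using kX kY z by (simp add: add_mult_distrib_mat_vec[OF kX _ z(1)] smult_mat_mult_vec)
    also have "\<dots> = vectorise (Z * X\<^sup>T + c \<cdot>\<^sub>m (K * Z * Y\<^sup>T))"
      using X Y K Z
      by (simp add: z_eq kron_mult_vectorise[OF X one_carrier_mat Z] kron_mult_vectorise[OF Y K Z] vectorise_smult
          vectorise_add[of _ M N] left_mult_one_mat[OF Z])
    finally show ?thesis ..
  qed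
  then have eqZ: "Z * X\<^sup>T + c \<cdot>\<^sub>m (K * Z * Y\<^sup>T) = 0\<^sub>m M N"
    using ker X Y K Z by (subst vectorise_eq_0_iff[symmetric]) auto
  obtain T P Q where "schur_decomposition K es = (T, P, Q)"
    by (cases "schur_decomposition K es")
  from schur_decomposition[OF K cp this]
  have sim: "similar_mat_wit K T P Q" and tri: "upper_triangular T" and diag: "diag_mat T = es"
    by blast+
  note wit = similar_mat_witD2[OF K sim]
  have simi: "P * Q = 1\<^sub>m M" "Q * P = 1\<^sub>m M" "K = P * T * Q"
    by (fact wit)+
  have car: "T \<in> carrier_mat M M" "P \<in> carrier_mat M M" "Q \<in> carrier_mat M M"
    by (fact wit)+
  define W where "W = Q * Z"
  have W: "W \<in> carrier_mat M N" using car Z by (simp add: W_def)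
  have "W \<noteq> 0\<^sub>m M N"
  proof
    assume "W = 0\<^sub>m M N"
    moreover have "P * W = P * Q * Z"
      unfolding W_def by (rule assoc_mult_mat[OF car(2,3) Z, symmetric])
    then have "Z = P * W" using simi Z by simp
    ultimately have "Z = 0\<^sub>m M N" using car by simp
    then show False using z Z by (simp add: z_eq vectorise_eq_0_iff)
  qed
  moreover have "W = 0\<^sub>m M N" if "\<And>x. x < M \<Longrightarrow> row W x = 0\<^sub>v N"
    using that W by (intro eq_rowI) auto
  ultimately have "\<exists>x<M. row W x \<noteq> 0\<^sub>v N"
    by blast
  define S where "S = {x. x < M \<and> row W x \<noteq> 0\<^sub>v N}"
  \<comment> \<open>the last non-zero row of \<open>W\<close>\<close>
  define i where "i = Max S"
  have fin: "finite S" by (simp add: S_def)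
  have "i \<in> S"
    unfolding i_def by (rule Max_in[OF fin]) (use \<open>\<exists>x<M. row W x \<noteq> 0\<^sub>v N\<close> in \<open>auto simp: S_def\<close>)
  then have i: "i < M" "row W i \<noteq> 0\<^sub>v N" by (auto simp: S_def)
  have below: "W $$ (j, k) = 0" if "i < j" "j < M" "k < N" for j k
  proof -
    have "j \<notin> S"
      using Max_ge[OF fin, of j] that(1) unfolding i_def by linarith
    then have "row W j = 0\<^sub>v N" using that by (simp add: S_def)
    then have "row W j $ k = 0" using that by simp
    then show ?thesis using W that by simp
  qed
  have eqW: "W * X\<^sup>T + c \<cdot>\<^sub>m (T * W * Y\<^sup>T) = 0\<^sub>m M N"
  proof -
    have "Q * K = Q * P * (T * Q)"
      using car simi(3) by (simp add: assoc_mult_mat[of Q M M P M "T * Q" M])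
    also have "\<dots> = T * Q"
      using car simi(2) by simp
    finally have QK: "Q * K = T * Q" .
    have "Q * (Z * X\<^sup>T + c \<cdot>\<^sub>m (K * Z * Y\<^sup>T)) = Q * (Z * X\<^sup>T) + c \<cdot>\<^sub>m (Q * (K * Z * Y\<^sup>T))"
      using car K X Y Z
      by (simp add: mult_add_distrib_mat[of _ M M _ N] mult_smult_distrib[of _ M M _ N])
    also have "Q * (Z * X\<^sup>T) = W * X\<^sup>T"
      using car X Z by (simp add: W_def)
    also have "Q * (K * Z * Y\<^sup>T) = Q * K * (Z * Y\<^sup>T)"
      using car K Y Z by (simp add: assoc_mult_mat[of Q M M K M "Z * Y\<^sup>T" N])
    also have "\<dots> = T * W * Y\<^sup>T"
      using car Y Z by (simp add: QK W_def assoc_mult_mat[of T M M Q M "Z * Y\<^sup>T" N]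
          assoc_mult_mat[of T M M "Q * Z" N "Y\<^sup>T" N] assoc_mult_mat[of Q M M Z N "Y\<^sup>T" N])
    finally show ?thesis using car by (simp add: eqZ)
  qed
  have TW: "(T * W) $$ (i, k) = T $$ (i, i) * W $$ (i, k)" if "k < N" for k
  proof -
    have "(T * W) $$ (i, k) = (\<Sum>j<M. T $$ (i, j) * W $$ (j, k))"
      using car W i that by (simp add: scalar_prod_def atLeast0LessThan)
    also have "\<dots> = (\<Sum>j<M. if j = i then T $$ (i, i) * W $$ (i, k) else 0)"
    proof (intro sum.cong refl)
      fix j assume j: "j \<in> {..<M}"
      show "T $$ (i, j) * W $$ (j, k) = (if j = i then T $$ (i, i) * W $$ (i, k) else 0)"
        using below[of j k] j i that car tri
        by (cases j i rule: linorder_cases) (auto dest: upper_triangularD)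
    qed
    finally show ?thesis using i by simp
  qed
  \<comment> \<open>with the product named, the simplifier cannot reassociate \<open>T * W * Y\<^sup>T\<close> and block \<open>TW\<close>\<close>
  define V where "V = T * W"
  have V: "V \<in> carrier_mat M N" using car W by (simp add: V_def)
  show thesis
  proof
    show "T $$ (i, i) \<in> set es"
      unfolding diag[symmetric] diag_mat_def using i car by auto
    show "row W i \<in> carrier_vec N" by (rule carrier_vecI) (use W in simp)
    show "row W i \<noteq> 0\<^sub>v N" by (fact i)
    show "(X + (c * T $$ (i, i)) \<cdot>\<^sub>m Y) *\<^sub>v row W i = 0\<^sub>v N"
    proof (rule eq_vecI)
      fix l assume "l < dim_vec (0\<^sub>v N :: 'a vec)"
      then have l: "l < N" by simp
      have "((X + (c * T $$ (i, i)) \<cdot>\<^sub>m Y) *\<^sub>v row W i) $ l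
          = (\<Sum>k<N. (X $$ (l, k) + c * T $$ (i, i) * Y $$ (l, k)) * W $$ (i, k))"
        using X Y W i l by (simp add: scalar_prod_def atLeast0LessThan)
      also have "\<dots> = (\<Sum>k<N. W $$ (i, k) * X $$ (l, k)) + c * (\<Sum>k<N. V $$ (i, k) * Y $$ (l, k))"
        by (simp add: V_def TW sum.distrib sum_distrib_left algebra_simps)
      also have "\<dots> = (W * X\<^sup>T + c \<cdot>\<^sub>m (V * Y\<^sup>T)) $$ (i, l)"
        using X Y W V i l by (simp add: scalar_prod_def atLeast0LessThan)
      finally show "((X + (c * T $$ (i, i)) \<cdot>\<^sub>m Y) *\<^sub>v row W i) $ l = 0\<^sub>v N $ l"
        using eqW[folded V_def] i l by simp
    qed (use X Y in simp)
  qed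
qed

section \<open>The scalar symbols of the system and of the preconditioner\<close>

lemma C_mat_mult_vec_index:
  assumes "L > 1" "v \<in> carrier_vec L" "l < L"
  shows "(C_mat L \<alpha> *\<^sub>v v) $ l = v $ l - (if l = 0 then of_real \<alpha> * v $ (L - 1) else v $ (l - 1))"
proof -
  have "(C_mat L \<alpha> *\<^sub>v v) $ l = (\<Sum>j<L. C_mat L \<alpha> $$ (l, j) * v $ j)"
    using assms by (simp add: C_mat_def scalar_prod_def atLeast0LessThan)
  also have "\<dots> = (\<Sum>j<L. (if j = l then v $ j else 0)
      - (if j = (if l = 0 then L - 1 else l - 1) then (if l = 0 then of_real \<alpha> * v $ j else v $ j) else 0))"
    using assms by (intro sum.cong) (auto simp: C_mat_def B_mat_def)
  also have "\<dots> = v $ l - (if l = 0 then of_real \<alpha> * v $ (L - 1) else v $ (l - 1))"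
    using assms by (simp add: sum_subtractf)
  finally show ?thesis .
qed

lemma adjoint_C_mat_mult_vec_index:
  assumes "L > 1" "v \<in> carrier_vec L" "l < L"
  shows "(mat_adjoint (C_mat L \<alpha>) *\<^sub>v v) $ l
    = v $ l - (if l = L - 1 then of_real \<alpha> * v $ 0 else v $ Suc l)"
proof -
  have "(mat_adjoint (C_mat L \<alpha>) *\<^sub>v v) $ l = (\<Sum>j<L. cnj (C_mat L \<alpha> $$ (j, l)) * v $ j)"
    using assms by (simp add: index_mat_adjoint C_mat_def scalar_prod_def atLeast0LessThan)
  also have "\<dots> = (\<Sum>j<L. (if j = l then v $ j else 0)
      - (if j = (if l = L - 1 then 0 else Suc l) then (if l = L - 1 then of_real \<alpha> * v $ j else v $ j) else 0))"
    using assms by (intro sum.cong) (auto simp: C_mat_def B_mat_def)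
  also have "\<dots> = v $ l - (if l = L - 1 then of_real \<alpha> * v $ 0 else v $ Suc l)"
    using assms by (cases "l = L - 1") (simp_all add: sum_subtractf)
  finally show ?thesis .
qed

lemma E_mat_mult_vec_index:
  assumes "v \<in> carrier_vec L" "l < L"
  shows "(- E_mat L *\<^sub>v v) $ l = (if l = L - 1 then - v $ (L - 1) else 0)"
proof -
  have "(E_mat L *\<^sub>v v) $ l = (\<Sum>j<L. E_mat L $$ (l, j) * v $ j)"
    using assms by (simp add: E_mat_def scalar_prod_def atLeast0LessThan)
  also have "\<dots> = (\<Sum>j<L. if j = L - 1 then (if l = L - 1 then v $ j else 0) else 0)"
    using assms by (intro sum.cong) (auto simp: E_mat_def)
  also have "\<dots> = (if l = L - 1 then v $ (L - 1) else 0)"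
    using assms by simp
  finally show ?thesis
    using assms by (simp add: uminus_mult_mat_vec E_mat_def del: index_mult_mat_vec)
qed

text \<open>The time-stepping matrix is the \<open>\<alpha>\<close>-circulant one with \<open>\<alpha> = 0\<close>, so one computation of rows
  serves both. For \<open>L = 1\<close> this fails, because the corner then lies on the diagonal.\<close>

lemma B_mat_eq_C_mat: "L > 1 \<Longrightarrow> B_mat L = C_mat L 0"
  by (rule eq_matI) (auto simp: B_mat_def C_mat_def)

lemma transpose_C_mat: "transpose_mat (C_mat L \<alpha>) = mat_adjoint (C_mat L \<alpha>)"
  by (rule eq_matI) (auto simp: B_mat_def C_mat_def index_mat_adjoint)

lemma mat_carriers [simp]:
  "B_mat L \<in> carrier_mat L L" "C_mat L \<alpha> \<in> carrier_mat L L" "E_mat L \<in> carrier_mat L L"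
  "mat_adjoint (C_mat L \<alpha>) \<in> carrier_mat L L"
  by (auto simp: B_mat_def C_mat_def E_mat_def)

text \<open>The time factors of the two terms in \<open>A = A_time \<otimes> I + \<tau> (A_space \<otimes> K)\<close> and in the
  analogous splitting of the preconditioner. The argument \<open>\<kappa>\<close> stands for \<open>\<tau> / \<gamma>\<close>.\<close>

definition A_time :: "nat \<Rightarrow> complex \<Rightarrow> complex mat" where
  "A_time L \<kappa> = four_block_mat (B_mat L) (\<kappa> \<cdot>\<^sub>m 1\<^sub>m L) (- E_mat L) (transpose_mat (B_mat L))"

definition A_space :: "nat \<Rightarrow> complex mat" where
  "A_space L = four_block_mat (1\<^sub>m L) (0\<^sub>m L L) (- E_mat L) (1\<^sub>m L)"

definition P_time :: "nat \<Rightarrow> complex \<Rightarrow> real \<Rightarrow> complex mat" where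
  "P_time L \<kappa> \<alpha> = four_block_mat (C_mat L \<alpha>) (\<kappa> \<cdot>\<^sub>m 1\<^sub>m L) (0\<^sub>m L L) (mat_adjoint (C_mat L \<alpha>))"

definition P_space :: "nat \<Rightarrow> complex mat" where
  "P_space L = four_block_mat (1\<^sub>m L) (0\<^sub>m L L) (0\<^sub>m L L) (1\<^sub>m L)"

lemma symbol_carriers [simp]:
  "A_time L \<kappa> \<in> carrier_mat (L + L) (L + L)" "A_space L \<in> carrier_mat (L + L) (L + L)"
  "P_time L \<kappa> \<alpha> \<in> carrier_mat (L + L) (L + L)" "P_space L \<in> carrier_mat (L + L) (L + L)"
  unfolding A_time_def A_space_def P_time_def P_space_def by (rule four_block_carrier_mat; simp)+

lemma symbol_dims [simp]:
  "dim_col (A_space L) = L + L" "dim_row (A_space L) = L + L"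
  "dim_col (P_space L) = L + L" "dim_row (P_space L) = L + L"
  by (rule carrier_matD[OF symbol_carriers(2)] carrier_matD[OF symbol_carriers(4)])+

text \<open>Self-adjointness of \<open>K\<close> enters here: state and adjoint blocks then contain the same space
  matrix, and a single Kronecker product with \<open>K\<close> covers both.\<close>

lemma A_mat_eq_kron:
  assumes "K \<in> carrier_mat M M" "mat_adjoint K = K"
  shows "A_mat L \<tau> \<gamma> K
    = A_time L (of_real (\<tau> / \<gamma>)) \<otimes>\<^sub>K 1\<^sub>m M + of_real \<tau> \<cdot>\<^sub>m (A_space L \<otimes>\<^sub>K K)"
proof -
  have "A_space L \<otimes>\<^sub>K K = four_block_mat (1\<^sub>m L \<otimes>\<^sub>K K) (0\<^sub>m L L \<otimes>\<^sub>K K) (- E_mat L \<otimes>\<^sub>K K) (1\<^sub>m L \<otimes>\<^sub>K K)"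
    unfolding A_space_def by (rule kron_four_block) auto
  then show ?thesis
    using assms by (simp add: A_mat_def A_time_def zero_kron Let_def)
qed

lemma P_mat_eq_kron:
  assumes "K \<in> carrier_mat M M" "mat_adjoint K = K"
  shows "P_mat L \<tau> \<gamma> \<alpha> K
    = P_time L (of_real (\<tau> / \<gamma>)) \<alpha> \<otimes>\<^sub>K 1\<^sub>m M + of_real \<tau> \<cdot>\<^sub>m (P_space L \<otimes>\<^sub>K K)"
proof -
  have "P_space L \<otimes>\<^sub>K K = four_block_mat (1\<^sub>m L \<otimes>\<^sub>K K) (0\<^sub>m L L \<otimes>\<^sub>K K) (0\<^sub>m L L \<otimes>\<^sub>K K) (1\<^sub>m L \<otimes>\<^sub>K K)"
    unfolding P_space_def by (rule kron_four_block) auto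
  then show ?thesis
    using assms by (simp add: P_mat_def P_time_def zero_kron Let_def)
qed

text \<open>The rows of the two symbols at \<open>t = \<tau> \<sigma>\<close>, applied to a state \<open>v\<close> and an adjoint \<open>w\<close>. They
  differ only in the state row \<open>0\<close> and in the adjoint row \<open>L - 1\<close>.\<close>

lemma A_symbol_index:
  assumes L: "L > 1" and v: "v \<in> carrier_vec L" and w: "w \<in> carrier_vec L" and l: "l < L"
  shows "((A_time L \<kappa> + t \<cdot>\<^sub>m A_space L) *\<^sub>v (v @\<^sub>v w)) $ l
      = (1 + t) * v $ l - (if l = 0 then 0 else v $ (l - 1)) + \<kappa> * w $ l" (is ?upper)
    and "((A_time L \<kappa> + t \<cdot>\<^sub>m A_space L) *\<^sub>v (v @\<^sub>v w)) $ (L + l)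
      = (1 + t) * w $ l - (if l = L - 1 then (1 + t) * v $ (L - 1) else w $ Suc l)" (is ?lower)
proof -
  have vw: "v @\<^sub>v w \<in> carrier_vec (L + L)" using v w by simp
  have time: "A_time L \<kappa> *\<^sub>v (v @\<^sub>v w)
      = (C_mat L 0 *\<^sub>v v + \<kappa> \<cdot>\<^sub>v w) @\<^sub>v (- E_mat L *\<^sub>v v + mat_adjoint (C_mat L 0) *\<^sub>v w)"
    unfolding A_time_def using v w L
    by (subst four_block_mat_mult_vec[of _ L L _ L _ L])
      (simp_all add: smult_mat_mult_vec B_mat_eq_C_mat transpose_C_mat)
  have space: "A_space L *\<^sub>v (v @\<^sub>v w) = v @\<^sub>v (- E_mat L *\<^sub>v v + w)"
    unfolding A_space_def using v w
    by (subst four_block_mat_mult_vec[of _ L L _ L _ L]) (simp_all add: zero_mat_mult_vec)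
  have eq: "(A_time L \<kappa> + t \<cdot>\<^sub>m A_space L) *\<^sub>v (v @\<^sub>v w)
      = A_time L \<kappa> *\<^sub>v (v @\<^sub>v w) + t \<cdot>\<^sub>v (A_space L *\<^sub>v (v @\<^sub>v w))"
    using vw smult_mat_mult_vec[of "v @\<^sub>v w" "A_space L" t]
    by (simp add: add_mult_distrib_mat_vec[of _ "L + L" "L + L"])
  have dims: "dim_vec (C_mat L 0 *\<^sub>v v) = L" "dim_vec (mat_adjoint (C_mat L 0) *\<^sub>v w) = L"
    "dim_vec (- E_mat L *\<^sub>v v) = L"
    by (simp_all add: C_mat_def E_mat_def)
  show ?upper ?lower
    unfolding eq time space using v w l L dims
    by (simp_all add: C_mat_mult_vec_index[OF L v l] adjoint_C_mat_mult_vec_index[OF L w l]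
        E_mat_mult_vec_index[OF v l] algebra_simps del: index_mult_mat_vec)
qed

lemma P_symbol_index:
  assumes L: "L > 1" and v: "v \<in> carrier_vec L" and w: "w \<in> carrier_vec L" and l: "l < L"
  shows "((P_time L \<kappa> \<alpha> + t \<cdot>\<^sub>m P_space L) *\<^sub>v (v @\<^sub>v w)) $ l
      = (1 + t) * v $ l - (if l = 0 then of_real \<alpha> * v $ (L - 1) else v $ (l - 1)) + \<kappa> * w $ l" (is ?upper)
    and "((P_time L \<kappa> \<alpha> + t \<cdot>\<^sub>m P_space L) *\<^sub>v (v @\<^sub>v w)) $ (L + l)
      = (1 + t) * w $ l - (if l = L - 1 then of_real \<alpha> * w $ 0 else w $ Suc l)" (is ?lower)
proof -
  have vw: "v @\<^sub>v w \<in> carrier_vec (L + L)" using v w by simp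
  have adj: "mat_adjoint (C_mat L \<alpha>) *\<^sub>v w \<in> carrier_vec L"
    by (rule mult_mat_vec_carrier[OF mat_carriers(4) w])
  have time: "P_time L \<kappa> \<alpha> *\<^sub>v (v @\<^sub>v w)
      = (C_mat L \<alpha> *\<^sub>v v + \<kappa> \<cdot>\<^sub>v w) @\<^sub>v (mat_adjoint (C_mat L \<alpha>) *\<^sub>v w)"
    unfolding P_time_def using v w L
    by (subst four_block_mat_mult_vec[of _ L L _ L _ L])
      (simp_all add: smult_mat_mult_vec zero_mat_mult_vec left_zero_vec[OF adj])
  have space: "P_space L *\<^sub>v (v @\<^sub>v w) = v @\<^sub>v w"
    unfolding P_space_def using v w
    by (subst four_block_mat_mult_vec[of _ L L _ L _ L]) (simp_all add: zero_mat_mult_vec)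
  have eq: "(P_time L \<kappa> \<alpha> + t \<cdot>\<^sub>m P_space L) *\<^sub>v (v @\<^sub>v w)
      = P_time L \<kappa> \<alpha> *\<^sub>v (v @\<^sub>v w) + t \<cdot>\<^sub>v (P_space L *\<^sub>v (v @\<^sub>v w))"
    using vw smult_mat_mult_vec[of "v @\<^sub>v w" "P_space L" t]
    by (simp add: add_mult_distrib_mat_vec[of _ "L + L" "L + L"])
  have dims: "dim_vec (C_mat L \<alpha> *\<^sub>v v) = L" "dim_vec (mat_adjoint (C_mat L \<alpha>) *\<^sub>v w) = L"
    by (simp_all add: C_mat_def)
  show ?upper ?lower
    unfolding eq time space using v w l L dims
    by (simp_all add: C_mat_mult_vec_index[OF L v l] adjoint_C_mat_mult_vec_index[OF L w l]
        algebra_simps del: index_mult_mat_vec)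
qed

section \<open>Solving the scalar problem by sweeps in time\<close>

text \<open>Here \<open>s = 1 + \<tau> \<sigma>\<close> is the implicit Euler factor, and the premises are the rows of
  \<open>p \<zeta> = \<eta> (a - p) \<zeta>\<close>. The adjoint is swept backward from its last value, then the state forward
  from its first row, where the last state enters through the \<open>\<alpha>\<close>-coupling.
  Evaluating the two closed forms at the respective far ends gives two equations for the end
  values. The geometric sum in \<open>\<phi>\<^sup>2\<close> arises because the source in the state recurrence
  already carries a power of \<open>\<phi>\<close> from the backward sweep.\<close>

lemma backward_forward_sweep:
  fixes y lam :: "nat \<Rightarrow> complex" and s \<kappa> \<alpha> \<eta> \<phi> \<psi> :: complex
  assumes L: "L > 0" and s: "s \<noteq> 0" and \<phi>: "\<phi> = inverse s" and \<psi>: "\<psi> = \<kappa> * inverse s"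
    and y_first: "s * y 0 - \<alpha> * y (L - 1) + \<kappa> * lam 0 = \<eta> * (\<alpha> * y (L - 1))"
    and y_step: "\<And>l. Suc l < L \<Longrightarrow> s * y (Suc l) - y l + \<kappa> * lam (Suc l) = 0"
    and lam_step: "\<And>l. Suc l < L \<Longrightarrow> s * lam l - lam (Suc l) = 0"
    and lam_last: "s * lam (L - 1) - \<alpha> * lam 0 = \<eta> * (\<alpha> * lam 0 - s * y (L - 1))"
  shows "l < L \<Longrightarrow> lam l = \<phi> ^ (L - 1 - l) * lam (L - 1)"
    and "l < L \<Longrightarrow> y l = \<phi> ^ Suc l * (\<alpha> * (1 + \<eta>)) * y (L - 1)
          - \<psi> * lam (L - 1) * (\<Sum>i\<le>l. \<phi> ^ (l - i) * \<phi> ^ (L - 1 - i))"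
    and "\<phi>\<^sup>2 \<noteq> 1 \<Longrightarrow> y (L - 1) * (1 - \<alpha> * \<phi> ^ L)
          = \<eta> * (\<alpha> * \<phi> ^ L * y (L - 1)) - \<psi> * ((1 - \<phi> ^ (2 * L)) / (1 - \<phi>\<^sup>2)) * lam (L - 1)"
    and "lam (L - 1) * (1 - \<alpha> * \<phi> ^ L) = \<eta> * (\<alpha> * \<phi> * lam 0 - y (L - 1))"
proof -
  have s\<phi>: "s * \<phi> = 1" using s \<phi> by simp
  have \<psi>': "\<psi> = \<kappa> * \<phi>" using \<phi> \<psi> by simp
  have div: "v = \<phi> * w" if "s * v = w" for v w :: complex
    using that s by (auto simp: \<phi>)
  show lam: "lam l = \<phi> ^ (L - 1 - l) * lam (L - 1)" if "l < L" for l
    using that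
  proof (induction "L - 1 - l" arbitrary: l)
    case 0
    then have "l = L - 1" by simp
    then show ?case by simp
  next
    case (Suc n)
    then have "Suc l < L" "L - 1 - l = Suc (L - 1 - Suc l)" "n = L - 1 - Suc l" by auto
    then show ?case
      using div[of "lam l" "lam (Suc l)"] lam_step[of l] Suc.hyps(1)[of "Suc l"] by simp
  qed
  show y: "y l = \<phi> ^ Suc l * (\<alpha> * (1 + \<eta>)) * y (L - 1)
      - \<psi> * lam (L - 1) * (\<Sum>i\<le>l. \<phi> ^ (l - i) * \<phi> ^ (L - 1 - i))" if "l < L" for l
    using that
  proof (induction l)
    case 0
    have "y 0 = \<phi> * (\<alpha> * (1 + \<eta>) * y (L - 1) - \<kappa> * lam 0)"
      using y_first by (intro div) (simp add: algebra_simps)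
    then show ?case using lam[OF 0] by (simp add: \<psi>' algebra_simps)
  next
    case (Suc l)
    have "y (Suc l) = \<phi> * (y l - \<kappa> * lam (Suc l))"
      using y_step[OF Suc.prems] by (intro div) (simp add: algebra_simps)
    moreover have "(\<Sum>i\<le>Suc l. \<phi> ^ (Suc l - i) * \<phi> ^ (L - 1 - i))
        = \<phi> * (\<Sum>i\<le>l. \<phi> ^ (l - i) * \<phi> ^ (L - 1 - i)) + \<phi> ^ (L - 1 - Suc l)"
      by (simp add: sum_distrib_left Suc_diff_le mult.assoc)
    ultimately show ?case
      using Suc lam[OF Suc.prems] by (simp add: \<psi>' algebra_simps)
  qed
  have lam0: "lam 0 = \<phi> ^ (L - 1) * lam (L - 1)" using lam[of 0] L by simp
  have \<phi>L: "\<phi> ^ L = \<phi> * \<phi> ^ (L - 1)" using L by (simp add: power_eq_if)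
  show "lam (L - 1) * (1 - \<alpha> * \<phi> ^ L) = \<eta> * (\<alpha> * \<phi> * lam 0 - y (L - 1))"
  proof -
    have "lam (L - 1) = \<phi> * (\<alpha> * lam 0 + \<eta> * (\<alpha> * lam 0 - s * y (L - 1)))"
      using lam_last by (intro div) (simp add: algebra_simps)
    also have "\<dots> = \<alpha> * \<phi> * lam 0 + \<eta> * (\<alpha> * \<phi> * lam 0 - (s * \<phi>) * y (L - 1))"
      by (simp add: algebra_simps)
    also have "\<dots> = \<alpha> * \<phi> * lam 0 + \<eta> * (\<alpha> * \<phi> * lam 0 - y (L - 1))"
      by (simp only: s\<phi> mult_1_left)
    finally have "lam (L - 1) - \<alpha> * \<phi> * lam 0 = \<eta> * (\<alpha> * \<phi> * lam 0 - y (L - 1))"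
      by (simp add: algebra_simps)
    then show ?thesis by (simp add: lam0 \<phi>L algebra_simps)
  qed
  show "y (L - 1) * (1 - \<alpha> * \<phi> ^ L)
      = \<eta> * (\<alpha> * \<phi> ^ L * y (L - 1)) - \<psi> * ((1 - \<phi> ^ (2 * L)) / (1 - \<phi>\<^sup>2)) * lam (L - 1)"
    if "\<phi>\<^sup>2 \<noteq> 1"
  proof -
    have "{..L - 1} = {..<L}" using L by auto
    then have "(\<Sum>i\<le>L - 1. \<phi> ^ (L - 1 - i) * \<phi> ^ (L - 1 - i)) = (\<Sum>i<L. (\<phi>\<^sup>2) ^ (L - Suc i))"
      by (simp add: power2_eq_square power_mult_distrib)
    also have "\<dots> = (\<Sum>i<L. (\<phi>\<^sup>2) ^ i)"
      by (rule sum.nat_diff_reindex)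
    also have "\<dots> = (1 - \<phi> ^ (2 * L)) / (1 - \<phi>\<^sup>2)"
      using that by (simp add: sum_gp_strict power_mult)
    finally show ?thesis
      using y[of "L - 1"] L by (simp add: algebra_simps)
  qed
qed

text \<open>The two end equations of the sweeps are the rows of the eigenvalue equation for
  \<open>W_mat\<close> at \<open>(y\<^sub>L\<^sub>-\<^sub>1, \<lambda>\<^sub>0)\<close>. This vector is non-zero: if both entries vanish, then
  so does the last adjoint value, hence the whole adjoint by the backward sweep, and then the whole
  state by the forward sweep. For \<open>\<eta> = 0\<close> the end equations force both end values to vanish, which is
  impossible for the same reason.\<close>

lemma symbol_resonance:
  fixes \<kappa> s \<phi> \<psi> \<eta> :: complex and \<alpha> :: real
  assumes L: "L > 1" and s: "1 + t \<noteq> 0" and \<phi>: "\<phi> = inverse (1 + t)" and \<psi>: "\<psi> = \<kappa> * inverse (1 + t)"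
    and \<phi>2: "\<phi>\<^sup>2 \<noteq> 1" and \<alpha>: "of_real \<alpha> * \<phi> ^ L \<noteq> 1"
    and v: "v \<in> carrier_vec L" and w: "w \<in> carrier_vec L" and nz: "v @\<^sub>v w \<noteq> 0\<^sub>v (L + L)"
    and res: "(P_time L \<kappa> \<alpha> + t \<cdot>\<^sub>m P_space L) *\<^sub>v (v @\<^sub>v w)
      = \<eta> \<cdot>\<^sub>v ((A_time L \<kappa> + t \<cdot>\<^sub>m A_space L) *\<^sub>v (v @\<^sub>v w)
          - (P_time L \<kappa> \<alpha> + t \<cdot>\<^sub>m P_space L) *\<^sub>v (v @\<^sub>v w))"
  shows "\<eta> \<noteq> 0" and "eigenvalue (W_mat L (of_real \<alpha>) \<phi> \<psi>) (inverse \<eta>)"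
proof -
  define A where "A = A_time L \<kappa> + t \<cdot>\<^sub>m A_space L"
  define P where "P = P_time L \<kappa> \<alpha> + t \<cdot>\<^sub>m P_space L"
  have dims: "dim_vec (A *\<^sub>v (v @\<^sub>v w)) = L + L" "dim_vec (P *\<^sub>v (v @\<^sub>v w)) = L + L"
    unfolding A_def P_def by simp_all
  note A_index = A_symbol_index[OF L v w, of _ \<kappa> t, folded A_def]
  note P_index = P_symbol_index[OF L v w, of _ \<kappa> \<alpha> t, folded P_def]
  have res': "(P *\<^sub>v (v @\<^sub>v w)) $ i = \<eta> * ((A *\<^sub>v (v @\<^sub>v w)) $ i - (P *\<^sub>v (v @\<^sub>v w)) $ i)"
    if "i < L + L" for i
    using arg_cong[OF res[folded A_def P_def], of "\<lambda>u. u $ i"] that dims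
    by (simp del: index_mult_mat_vec)
  define lam where "lam = w $ 0"
  define y where "y = v $ (L - 1)"
  define \<mu> where "\<mu> = w $ (L - 1)"
  have first: "(1 + t) * v $ 0 - of_real \<alpha> * v $ (L - 1) + \<kappa> * w $ 0 = \<eta> * (of_real \<alpha> * v $ (L - 1))"
    using res'[of 0] A_index(1)[of 0] P_index(1)[of 0] L by (simp del: index_mult_mat_vec)
  have step: "(1 + t) * v $ Suc l - v $ l + \<kappa> * w $ Suc l = 0"
    "(1 + t) * w $ l - w $ Suc l = 0" if l: "Suc l < L" for l
  proof -
    have "l \<noteq> L - 1" using l by simp
    then show "(1 + t) * v $ Suc l - v $ l + \<kappa> * w $ Suc l = 0" "(1 + t) * w $ l - w $ Suc l = 0"
      using res'[of "Suc l"] A_index(1)[of "Suc l"] P_index(1)[of "Suc l"]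
        res'[of "L + l"] A_index(2)[of l] P_index(2)[of l] l
      by (simp_all del: index_mult_mat_vec)
  qed
  have last: "(1 + t) * w $ (L - 1) - of_real \<alpha> * w $ 0
      = \<eta> * (of_real \<alpha> * w $ 0 - (1 + t) * v $ (L - 1))"
    using res'[of "L + (L - 1)"] A_index(2)[of "L - 1"] P_index(2)[of "L - 1"] L
    by (simp del: index_mult_mat_vec)
  have "L > 0" using L by simp
  note sweep = backward_forward_sweep[of L "1 + t" \<phi> \<psi> \<kappa> "($) v" "of_real \<alpha>" "($) w" \<eta>,
      OF \<open>L > 0\<close> s \<phi> \<psi> first step last]
  define D where "D = 1 - of_real \<alpha> * \<phi> ^ L"
  define S where "S = (1 - \<phi> ^ (2 * L)) / (1 - \<phi>\<^sup>2)"
  have D: "D \<noteq> 0" using \<alpha> by (simp add: D_def)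
  have y_end: "y * D = \<eta> * (of_real \<alpha> * \<phi> ^ L * y) - \<psi> * S * \<mu>"
    using sweep(3)[OF _ _ \<phi>2] by (simp add: y_def \<mu>_def D_def S_def)
  have \<mu>_end: "\<mu> * D = \<eta> * (of_real \<alpha> * \<phi> * lam - y)"
    using sweep(4) by (simp add: y_def \<mu>_def lam_def D_def)
  have lam_eq: "lam = \<phi> ^ (L - 1) * \<mu>"
    using sweep(1)[of 0] L by (simp add: lam_def \<mu>_def)
  have \<phi>L: "\<phi> ^ L = \<phi> ^ (L - 1) * \<phi>"
    using L by (simp add: power_eq_if)
  have ends_nonzero: "y \<noteq> 0 \<or> \<mu> \<noteq> 0"
  proof (rule ccontr)
    assume "\<not> (y \<noteq> 0 \<or> \<mu> \<noteq> 0)"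
    then have zero: "v $ (L - 1) = 0" "w $ (L - 1) = 0" by (auto simp: y_def \<mu>_def)
    have "w $ l = 0" "v $ l = 0" if "l < L" for l
      using sweep(1)[of l] sweep(2)[of l] that zero by simp_all
    then have "v @\<^sub>v w = 0\<^sub>v (L + L)"
      using v w by (intro eq_vecI) auto
    with nz show False ..
  qed
  show \<eta>: "\<eta> \<noteq> 0"
    using ends_nonzero y_end \<mu>_end D by auto
  have u_nonzero: "y \<noteq> 0 \<or> lam \<noteq> 0"
    using ends_nonzero \<mu>_end D by auto
  have lam_row: "inverse \<eta> * lam
      = - (\<phi> ^ (L - 1) / D) * y + of_real \<alpha> * \<phi> ^ L / D * lam"
  proof -
    have "\<mu> = \<eta> * ((of_real \<alpha> * \<phi> * lam - y) / D)"
      using \<mu>_end D by (simp add: field_simps)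
    then have "inverse \<eta> * \<mu> = (of_real \<alpha> * \<phi> * lam - y) / D"
      using \<eta> by simp
    then have "inverse \<eta> * lam = \<phi> ^ (L - 1) * ((of_real \<alpha> * \<phi> * lam - y) / D)"
      by (metis lam_eq mult.left_commute)
    then show ?thesis by (simp add: \<phi>L diff_divide_distrib algebra_simps)
  qed
  have y_row: "inverse \<eta> * y
      = (of_real \<alpha> * \<phi> ^ L / D + \<psi> / D\<^sup>2 * S) * y - of_real \<alpha> * \<phi> * \<psi> / D\<^sup>2 * S * lam"
  proof -
    define R where "R = of_real \<alpha> * \<phi> ^ L * y - \<psi> * S * ((of_real \<alpha> * \<phi> * lam - y) / D)"
    have "\<mu> = \<eta> * ((of_real \<alpha> * \<phi> * lam - y) / D)"
      using \<mu>_end D by (simp add: field_simps)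
    with y_end have "y * D = \<eta> * R"
      by (simp add: R_def algebra_simps)
    then have "inverse \<eta> * y = R / D"
      using D \<eta> by (simp add: field_simps)
    then show ?thesis unfolding R_def
      by (simp add: power2_eq_square diff_divide_distrib add_divide_distrib algebra_simps)
  qed
  define u where "u = vec_of_list [y, lam]"
  have "eigenvector (W_mat L (of_real \<alpha>) \<phi> \<psi>) u (inverse \<eta>)"
    unfolding eigenvector_def
  proof (intro conjI)
    show "u \<in> carrier_vec (dim_row (W_mat L (of_real \<alpha>) \<phi> \<psi>))"
      by (simp add: u_def W_mat_def mat_of_rows_list_def carrier_vecI)
    show "u \<noteq> 0\<^sub>v (dim_row (W_mat L (of_real \<alpha>) \<phi> \<psi>))"
    proof
      assume "u = 0\<^sub>v (dim_row (W_mat L (of_real \<alpha>) \<phi> \<psi>))"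
      then have "u $ 0 = 0" "u $ 1 = 0"
        by (simp_all add: W_mat_def mat_of_rows_list_def)
      with u_nonzero show False by (simp add: u_def)
    qed
    show "W_mat L (of_real \<alpha>) \<phi> \<psi> *\<^sub>v u = inverse \<eta> \<cdot>\<^sub>v u"
    proof (rule eq_vecI)
      fix i assume "i < dim_vec (inverse \<eta> \<cdot>\<^sub>v u)"
      then have "i = 0 \<or> i = 1" by (auto simp: u_def)
      then show "(W_mat L (of_real \<alpha>) \<phi> \<psi> *\<^sub>v u) $ i = (inverse \<eta> \<cdot>\<^sub>v u) $ i"
        using y_row lam_row unfolding D_def S_def
        by (auto simp: u_def W_mat_def mat_of_rows_list_def scalar_prod_def numeral_2_eq_2)
    qed (simp add: u_def W_mat_def mat_of_rows_list_def)
  qed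
  then show "eigenvalue (W_mat L (of_real \<alpha>) \<phi> \<psi>) (inverse \<eta>)"
    by (auto simp: eigenvalue_def)
qed

section \<open>The spectrum of the preconditioned matrix\<close>

theorem corollary3p2:
  fixes L M :: nat and \<tau> \<gamma> \<alpha> :: real and K :: "complex mat" and \<sigma> \<phi> \<psi> :: "nat \<Rightarrow> complex"
  assumes "L > 3" and "\<tau> > 0" and "\<gamma> > 0" and "\<alpha> \<noteq> 0"
    and "K \<in> carrier_mat M M" and "mat_adjoint K = K"
    and "char_poly K = (\<Prod>m\<in>{1..M}. [:- \<sigma> m, 1:])"
    and "\<And>m. m \<in> {1..M} \<Longrightarrow> 1 + of_real \<tau> * \<sigma> m \<noteq> 0"
    and "\<And>m. m \<in> {1..M} \<Longrightarrow> \<phi> m = inverse (1 + of_real \<tau> * \<sigma> m)"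
    and "\<And>m. m \<in> {1..M} \<Longrightarrow> \<psi> m = of_real (\<tau> / \<gamma>) * inverse (1 + of_real \<tau> * \<sigma> m)"
    and "\<And>m. m \<in> {1..M} \<Longrightarrow> \<phi> m \<noteq> 1 \<and> \<phi> m \<noteq> -1"
    and "\<And>m. m \<in> {1..M} \<Longrightarrow> of_real \<alpha> * \<phi> m ^ L \<noteq> 1"
  shows "\<exists>Pinv. mat_inverse (P_mat L \<tau> \<gamma> \<alpha> K) = Some Pinv \<and>
    (\<forall>\<theta>. eigenvalue (Pinv * A_mat L \<tau> \<gamma> K) \<theta> \<longrightarrow>
       \<theta> = 1 \<or> (\<exists>m\<in>{1..M}. \<exists>\<omega>. eigenvalue (W_mat L (of_real \<alpha>) (\<phi> m) (\<psi> m)) \<omega> \<and> \<theta> = 1 + \<omega>))"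
proof -
  define \<kappa> :: complex where "\<kappa> = of_real (\<tau> / \<gamma>)"
  define t where "t m = of_real \<tau> * \<sigma> m" for m
  define n where "n = (L + L) * M"
  define A where "A = A_mat L \<tau> \<gamma> K"
  define P where "P = P_mat L \<tau> \<gamma> \<alpha> K"
  let ?a = "\<lambda>m. A_time L \<kappa> + t m \<cdot>\<^sub>m A_space L"
  let ?p = "\<lambda>m. P_time L \<kappa> \<alpha> + t m \<cdot>\<^sub>m P_space L"
  have A_kron: "A = A_time L \<kappa> \<otimes>\<^sub>K 1\<^sub>m M + of_real \<tau> \<cdot>\<^sub>m (A_space L \<otimes>\<^sub>K K)"
    unfolding A_def \<kappa>_def by (rule A_mat_eq_kron[OF assms(5,6)])
  have P_kron: "P = P_time L \<kappa> \<alpha> \<otimes>\<^sub>K 1\<^sub>m M + of_real \<tau> \<cdot>\<^sub>m (P_space L \<otimes>\<^sub>K K)"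
    unfolding P_def \<kappa>_def by (rule P_mat_eq_kron[OF assms(5,6)])
  have kron_carrier: "X \<otimes>\<^sub>K Z \<in> carrier_mat n n"
    if "X \<in> carrier_mat (L + L) (L + L)" "Z \<in> carrier_mat M M" for X Z :: "complex mat"
    using that by (auto simp: kron_def n_def)
  have A: "A \<in> carrier_mat n n" and P: "P \<in> carrier_mat n n"
    unfolding A_kron P_kron using assms(5)
    by (intro add_carrier_mat smult_carrier_mat kron_carrier; simp)+
  have a: "?a m \<in> carrier_mat (L + L) (L + L)" and p: "?p m \<in> carrier_mat (L + L) (L + L)" for m
    by simp_all
  have resonance: "\<eta> \<noteq> 0" "eigenvalue (W_mat L (of_real \<alpha>) (\<phi> m) (\<psi> m)) (inverse \<eta>)"
    if m: "m \<in> {1..M}" and \<zeta>: "\<zeta> \<in> carrier_vec (L + L)" "\<zeta> \<noteq> 0\<^sub>v (L + L)"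
      and eq: "?p m *\<^sub>v \<zeta> = \<eta> \<cdot>\<^sub>v (?a m *\<^sub>v \<zeta> - ?p m *\<^sub>v \<zeta>)" for m \<zeta> \<eta>
  proof -
    obtain v w where vw: "v \<in> carrier_vec L" "w \<in> carrier_vec L" "\<zeta> = v @\<^sub>v w"
      using \<zeta>(1) vec_first_last_append[of \<zeta> L L] vec_first_carrier vec_last_carrier by metis
    have L: "L > 1" using assms(1) by simp
    have \<phi>2: "(\<phi> m)\<^sup>2 \<noteq> 1" using assms(11)[OF m] by (simp add: power2_eq_1_iff)
    note symbol_resonance[OF L, of "t m" "\<phi> m" "\<psi> m" \<kappa> \<alpha> v w \<eta>,
        OF _ _ _ \<phi>2 assms(12)[OF m] vw(1,2) \<zeta>(2)[unfolded vw(3)] eq[unfolded vw(3)]]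
    then show "\<eta> \<noteq> 0" "eigenvalue (W_mat L (of_real \<alpha>) (\<phi> m) (\<psi> m)) (inverse \<eta>)"
      using assms(8,9,10)[OF m] by (simp_all add: t_def \<kappa>_def)
  qed
  have cp: "char_poly K = (\<Prod>\<sigma>\<leftarrow>map \<sigma> [1..<Suc M]. [:- \<sigma>, 1:])"
  proof -
    have "(\<Prod>\<sigma>\<leftarrow>map \<sigma> [1..<Suc M]. [:- \<sigma>, 1:]) = (\<Prod>m\<in>set [1..<Suc M]. [:- \<sigma> m, 1:])"
      by (subst prod.distinct_set_conv_list) (simp_all add: comp_def)
    also have "set [1..<Suc M] = {1..M}" by auto
    finally show ?thesis using assms(7) by simp
  qed
  have reduce: "\<exists>m\<in>{1..M}. \<exists>\<zeta>\<in>carrier_vec (L + L). \<zeta> \<noteq> 0\<^sub>v (L + L) \<and>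
      (X + t m \<cdot>\<^sub>m Y) *\<^sub>v \<zeta> = 0\<^sub>v (L + L)"
    if XY: "X \<in> carrier_mat (L + L) (L + L)" "Y \<in> carrier_mat (L + L) (L + L)"
      and z: "z \<in> carrier_vec n" "z \<noteq> 0\<^sub>v n" "(X \<otimes>\<^sub>K 1\<^sub>m M + of_real \<tau> \<cdot>\<^sub>m (Y \<otimes>\<^sub>K K)) *\<^sub>v z = 0\<^sub>v n" for X Y z
  proof -
    obtain s \<zeta> where s: "s \<in> set (map \<sigma> [1..<Suc M])" and \<zeta>: "\<zeta> \<in> carrier_vec (L + L)"
      "\<zeta> \<noteq> 0\<^sub>v (L + L)" "(X + (of_real \<tau> * s) \<cdot>\<^sub>m Y) *\<^sub>v \<zeta> = 0\<^sub>v (L + L)"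
      using kron_pencil_kernel[OF assms(5) cp XY z[unfolded n_def]] by blast
    have "s \<in> \<sigma> ` {1..M}"
      using s by (simp only: set_map set_upt atLeastLessThanSuc_atLeastAtMost)
    then obtain m where "m \<in> {1..M}" "s = \<sigma> m" by blast
    with \<zeta> show ?thesis unfolding t_def by blast
  qed
  have "det P \<noteq> 0"
  proof
    assume "det P = 0"
    then obtain z where z: "z \<in> carrier_vec n" "z \<noteq> 0\<^sub>v n" "P *\<^sub>v z = 0\<^sub>v n"
      using det_0_iff_vec_prod_zero_field[OF P] by blast
    obtain m \<zeta> where m: "m \<in> {1..M}" and \<zeta>: "\<zeta> \<in> carrier_vec (L + L)" "\<zeta> \<noteq> 0\<^sub>v (L + L)"
      and ker: "?p m *\<^sub>v \<zeta> = 0\<^sub>v (L + L)"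
      using reduce[OF symbol_carriers(3,4) z[unfolded P_kron]] by blast
    \<comment> \<open>a kernel vector of \<open>p\<close> is a resonance at \<open>\<eta> = 0\<close>\<close>
    have "?p m *\<^sub>v \<zeta> = 0 \<cdot>\<^sub>v (?a m *\<^sub>v \<zeta> - ?p m *\<^sub>v \<zeta>)"
      using a[of m] p[of m] \<zeta> unfolding ker by (intro eq_vecI) auto
    from resonance(1)[OF m \<zeta> this] show False by simp
  qed
  then obtain Pinv where Pinv: "mat_inverse P = Some Pinv"
    using mat_inverse(1)[OF P, where b = "()"] det_non_zero_imp_unit[OF P, where b = "()"]
    by (cases "mat_inverse P") auto
  note inv = mat_inverse(2)[OF P Pinv]
  have "\<theta> = 1 \<or> (\<exists>m\<in>{1..M}. \<exists>\<omega>. eigenvalue (W_mat L (of_real \<alpha>) (\<phi> m) (\<psi> m)) \<omega> \<and> \<theta> = 1 + \<omega>)"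
    if ev: "eigenvalue (Pinv * A) \<theta>" for \<theta>
  proof (cases "\<theta> = 1")
    case False
    obtain z where z: "z \<in> carrier_vec n" "z \<noteq> 0\<^sub>v n" "(Pinv * A) *\<^sub>v z = \<theta> \<cdot>\<^sub>v z"
      using ev inv A unfolding eigenvalue_def eigenvector_def by auto
    have "A *\<^sub>v z = P *\<^sub>v ((Pinv * A) *\<^sub>v z)"
    proof -
      have "P *\<^sub>v ((Pinv * A) *\<^sub>v z) = (P * (Pinv * A)) *\<^sub>v z"
        by (rule assoc_mult_mat_vec[symmetric]) (use P inv A z in auto)
      also have "P * (Pinv * A) = P * Pinv * A"
        by (rule assoc_mult_mat[symmetric]) (use P inv A in auto)
      finally show ?thesis using inv A by simp
    qed
    then have Az: "A *\<^sub>v z = \<theta> \<cdot>\<^sub>v (P *\<^sub>v z)"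
      using z P by (simp add: mult_mat_vec)
    let ?X = "A_time L \<kappa> - \<theta> \<cdot>\<^sub>m P_time L \<kappa> \<alpha>" and ?Y = "A_space L - \<theta> \<cdot>\<^sub>m P_space L"
    have "?X \<otimes>\<^sub>K 1\<^sub>m M + of_real \<tau> \<cdot>\<^sub>m (?Y \<otimes>\<^sub>K K) = A - \<theta> \<cdot>\<^sub>m P"
      unfolding A_kron P_kron kron_diff_smult_left[OF symbol_carriers(1,3)]
        kron_diff_smult_left[OF symbol_carriers(2,4)]
      by (rule pencil_rearrange) (rule kron_carrier; use assms(5) in simp)+
    moreover have "(A - \<theta> \<cdot>\<^sub>m P) *\<^sub>v z = 0\<^sub>v n"
      using A P z by (simp add: minus_mult_distrib_mat_vec[of _ n n] smult_mat_mult_vec Az)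
    ultimately obtain m \<zeta> where m: "m \<in> {1..M}" and \<zeta>: "\<zeta> \<in> carrier_vec (L + L)" "\<zeta> \<noteq> 0\<^sub>v (L + L)"
      and "(?X + t m \<cdot>\<^sub>m ?Y) *\<^sub>v \<zeta> = 0\<^sub>v (L + L)"
      using reduce[of ?X ?Y z] z by (auto simp: minus_carrier_mat)
    then have "(?a m - \<theta> \<cdot>\<^sub>m ?p m) *\<^sub>v \<zeta> = 0\<^sub>v (L + L)"
      by (subst (asm) pencil_rearrange[of _ "L + L" "L + L"]) simp_all
    then have diff: "?a m *\<^sub>v \<zeta> - \<theta> \<cdot>\<^sub>v (?p m *\<^sub>v \<zeta>) = 0\<^sub>v (L + L)"
      using a[of m] p[of m] \<zeta>(1)
      by (simp add: minus_mult_distrib_mat_vec[of _ "L + L" "L + L"] smult_mat_mult_vec)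
    have "?p m *\<^sub>v \<zeta> = inverse (\<theta> - 1) \<cdot>\<^sub>v (?a m *\<^sub>v \<zeta> - ?p m *\<^sub>v \<zeta>)"
    proof (rule eq_vecI)
      fix i assume "i < dim_vec (inverse (\<theta> - 1) \<cdot>\<^sub>v (?a m *\<^sub>v \<zeta> - ?p m *\<^sub>v \<zeta>))"
      then have i: "i < L + L" by simp
      have "(?a m *\<^sub>v \<zeta>) $ i - \<theta> * (?p m *\<^sub>v \<zeta>) $ i = 0"
        using arg_cong[OF diff, of "\<lambda>u. u $ i"] i
        by (simp del: index_mult_mat_vec)
      then show "(?p m *\<^sub>v \<zeta>) $ i = (inverse (\<theta> - 1) \<cdot>\<^sub>v (?a m *\<^sub>v \<zeta> - ?p m *\<^sub>v \<zeta>)) $ i"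
        using False i
        by (simp del: index_mult_mat_vec add: field_simps)
    qed simp
    from resonance(2)[OF m \<zeta> this] m show ?thesis
      by (intro disjI2 bexI[of _ m] exI[of _ "\<theta> - 1"]) auto
  qed simp
  then show ?thesis using Pinv unfolding A_def P_def by blast
qed

end
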